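(* Let $\epsilon$ and $\delta$ be real numbers with $0<\epsilon<\frac{2}{5}$ and $0<\delta\le\frac{1}{30}$, and let $\tau$ be a positive integer. Suppose that $\Gamma$ is a $D$-regular graph on vertex set $[n]$ such that $\|Q^{\tau}_v-U\|<\delta$ for at least $\epsilon n$ vertices $v\in[n]$. Then there exists a set $V'$ of at most $5\delta n$ vertices such that the induced subgraph $\Gamma'$ of $\Gamma$ on $V(\Gamma)\setminus V'$, with $n'=|V(\Gamma')|$, satisfies: every vertex set $X\subseteq V(\Gamma')$ with $|X|\le\frac{1}{2}n'$ satisfies $e(X,V(\Gamma')\setminus X)\ge\frac{\epsilon D}{16\tau}|X|$.
   Context: All graphs are finite simple graphs; $D\ge 1$. For a $D$-regular graph $\Gamma$ on $[n]=\{1,\dots,n\}$, the random walk moves at each step to a uniformly random neighbor of the current vertex, independently of the history. $Q^t_v$ denotes the distribution of the position of the walk started at vertex $v$ after $t$ steps. $U$ is the uniform distribution on $[n]$. For probability distributions $P_1,P_2$ on $[n]$, $\|P_1-P_2\|=\max_{A\subseteq[n]}|P_1(A)-P_2(A)|=\frac12\sum_{j\in[n]}|P_1(j)-P_2(j)|$ (total variation distance). For vertex sets $X,Y$, $e(X,Y)$ is the number of edges with one endpoint in $X$ and the other in $Y$. *)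

theory Defs
  imports "HOL-Probability.Probability"
begin

text \<open>A finite simple graph is a finite vertex set together with a set of edges,
  each edge being a two-element set of vertices.\<close>

definition simple_graph :: "'a set \<Rightarrow> 'a set set \<Rightarrow> bool" where
  "simple_graph V E \<longleftrightarrow> finite V \<and> (\<forall>e\<in>E. e \<subseteq> V \<and> card e = 2)"

definition neighbors :: "'a set set \<Rightarrow> 'a \<Rightarrow> 'a set" where
  "neighbors E v = {w. {v, w} \<in> E}"

definition regular_graph :: "nat \<Rightarrow> 'a set \<Rightarrow> 'a set set \<Rightarrow> bool" where
  "regular_graph D V E \<longleftrightarrow> simple_graph V E \<and> (\<forall>v\<in>V. card (neighbors E v) = D)"

definition induced_edges :: "'a set set \<Rightarrow> 'a set \<Rightarrow> 'a set set" where
  "induced_edges E W = {e \<in> E. e \<subseteq> W}"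

definition edge_count :: "'a set set \<Rightarrow> 'a set \<Rightarrow> 'a set \<Rightarrow> nat" where
  "edge_count E X Y = card {e \<in> E. \<exists>x\<in>X. \<exists>y\<in>Y. e = {x, y}}"

text \<open>The distribution of the position after \<open>t\<close> steps of the random walk started at \<open>v\<close>.
  It is meaningful when every vertex reached has a finite, nonempty set of neighbors, as in a
  \<open>D\<close>-regular graph with \<open>D \<ge> 1\<close>.\<close>

primrec walk_dist :: "'a set set \<Rightarrow> nat \<Rightarrow> 'a \<Rightarrow> 'a pmf" where
  "walk_dist E 0 v = return_pmf v"
| "walk_dist E (Suc t) v = bind_pmf (walk_dist E t v) (\<lambda>w. pmf_of_set (neighbors E w))"

definition tv_dist :: "'a set \<Rightarrow> 'a pmf \<Rightarrow> 'a pmf \<Rightarrow> real" where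
  "tv_dist S p q = Max ((\<lambda>A. \<bar>measure_pmf.prob p A - measure_pmf.prob q A\<bar>) ` Pow S)"

lemma tv_dist_eq_half_sum:
  assumes S: "finite S" and p: "set_pmf p \<subseteq> S" and q: "set_pmf q \<subseteq> S"
  shows "tv_dist S p q = (\<Sum>j\<in>S. \<bar>pmf p j - pmf q j\<bar>) / 2"
proof -
  define d where "d j = pmf p j - pmf q j" for j
  have prob: "measure_pmf.prob p A - measure_pmf.prob q A = sum d A" if "A \<subseteq> S" for A
    using finite_subset[OF that S] by (simp add: measure_measure_pmf_finite d_def sum_subtractf)
  have d0: "sum d S = 0"
    using sum_pmf_eq_1[OF S p] sum_pmf_eq_1[OF S q] by (simp add: d_def sum_subtractf)
  have half: "2 * \<bar>sum d A\<bar> = \<bar>sum d A\<bar> + \<bar>sum d (S - A)\<bar>" if "A \<subseteq> S" for A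
    using sum.subset_diff[OF that S, of d] d0 by linarith
  have split: "(\<Sum>j\<in>S. \<bar>d j\<bar>) = (\<Sum>j\<in>S - A. \<bar>d j\<bar>) + (\<Sum>j\<in>A. \<bar>d j\<bar>)" if "A \<subseteq> S" for A
    using sum.subset_diff[OF that S] .
  have le: "\<bar>sum d A\<bar> \<le> (\<Sum>j\<in>S. \<bar>d j\<bar>) / 2" if "A \<subseteq> S" for A
    using half[OF that] split[OF that] sum_abs[of d A] sum_abs[of d "S - A"] by linarith
  define P where "P = {j \<in> S. d j \<ge> 0}"
  have PS: "P \<subseteq> S" by (auto simp: P_def)
  have "(\<Sum>j\<in>P. \<bar>d j\<bar>) = sum d P" "(\<Sum>j\<in>S - P. \<bar>d j\<bar>) = - sum d (S - P)"
    unfolding sum_negf[symmetric] by (auto simp: P_def intro!: sum.cong)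
  moreover have "sum d P \<ge> 0" by (auto simp: P_def intro!: sum_nonneg)
  ultimately have eq: "\<bar>sum d P\<bar> = (\<Sum>j\<in>S. \<bar>d j\<bar>) / 2"
    using split[OF PS] sum.subset_diff[OF PS S, of d] d0 by linarith
  have "Max ((\<lambda>A. \<bar>sum d A\<bar>) ` Pow S) = (\<Sum>j\<in>S. \<bar>d j\<bar>) / 2"
    using S PS le eq by (intro Max_eqI) (auto intro: image_eqI[where x = P])
  moreover have "(\<lambda>A. \<bar>measure_pmf.prob p A - measure_pmf.prob q A\<bar>) ` Pow S
      = (\<lambda>A. \<bar>sum d A\<bar>) ` Pow S"
    by (intro image_cong) (auto simp: prob)
  ultimately show ?thesis by (simp add: tv_dist_def d_def)
qed

end

theory Submission
  imports Defs
begin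

text \<open>Among the vertex sets \<open>S\<close> of size at most \<open>5\<delta>n\<close> sending at most \<open>\<epsilon>D|S|/(16\<tau>)\<close> edges
  to their complement, choose one of maximal size and remove it. If some \<open>X\<close> violated the expansion
  bound in what remains, then \<open>T = S \<union> X\<close> would again have a sparse boundary, while by maximality
  \<open>5\<delta>n < |T| \<le> 7n/12\<close>. Since the walk preserves the uniform distribution, a \<open>\<tau>\<close>-step walk with
  uniformly random start leaves \<open>T\<close> (or enters it) with probability at most \<open>\<tau>\<close> times the share of
  boundary edges. But at least \<open>\<epsilon>n\<close> starting vertices are \<open>\<delta>\<close>-mixed after \<open>\<tau>\<close> steps, and each
  of those ends on the other side with probability at least \<open>23|T|/(60n)\<close>; this is too much.\<close>

section \<open>Neighborhoods, one step of the walk, and its invariant uniform distribution\<close>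

lemma neighbors_subset:
  assumes "regular_graph D V E"
  shows "neighbors E v \<subseteq> V"
  using assms by (auto simp: regular_graph_def simple_graph_def neighbors_def)

lemma finite_neighbors:
  assumes "regular_graph D V E"
  shows "finite (neighbors E v)"
  using neighbors_subset[OF assms] assms
  by (auto simp: regular_graph_def simple_graph_def intro: finite_subset)

text \<open>Together with \<open>finite_neighbors\<close> this makes
  \<open>pmf_of_set (neighbors E w)\<close> a genuine uniform distribution:
  \<open>pmf_of_set\<close> is specified only for finite nonempty sets.\<close>

lemma neighbors_nonempty:
  assumes "regular_graph D V E" "D \<ge> 1" "v \<in> V"
  shows "neighbors E v \<noteq> {}"
  using assms by (auto simp: regular_graph_def)

lemma set_walk_dist_subset:
  assumes "regular_graph D V E" "D \<ge> 1" "v \<in> V"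
  shows "set_pmf (walk_dist E t v) \<subseteq> V"
proof (induction t)
  case 0
  then show ?case using assms by simp
next
  case (Suc t)
  show ?case
    using Suc neighbors_subset[OF assms(1)] finite_neighbors[OF assms(1)]
      neighbors_nonempty[OF assms(1,2)]
    by (auto simp: subset_iff)
qed

lemma pmf_walk_dist_Suc:
  assumes reg: "regular_graph D V E" and D: "D \<ge> 1" and v: "v \<in> V"
  shows "pmf (walk_dist E (Suc t) v) w
    = (\<Sum>u\<in>V. pmf (walk_dist E t v) u * (indicator (neighbors E u) w / D))"
proof -
  have fin: "finite V" using reg by (simp add: regular_graph_def simple_graph_def)
  have "pmf (walk_dist E (Suc t) v) w
    = (\<Sum>u\<in>V. pmf (pmf_of_set (neighbors E u)) w * pmf (walk_dist E t v) u)"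
    unfolding walk_dist.simps pmf_bind
    by (rule integral_measure_pmf_real[OF fin]) (use set_walk_dist_subset[OF assms] in auto)
  also have "\<dots> = (\<Sum>u\<in>V. pmf (walk_dist E t v) u * (indicator (neighbors E u) w / D))"
  proof (rule sum.cong[OF refl])
    fix u assume u: "u \<in> V"
    have "pmf (pmf_of_set (neighbors E u)) w = indicator (neighbors E u) w / D"
      using neighbors_nonempty[OF reg D u] finite_neighbors[OF reg] u reg
      by (simp add: regular_graph_def)
    then show "pmf (pmf_of_set (neighbors E u)) w * pmf (walk_dist E t v) u
      = pmf (walk_dist E t v) u * (indicator (neighbors E u) w / D)" by simp
  qed
  finally show ?thesis .
qed

lemma indicator_neighbors_commute:
  "indicator (neighbors E u) w = indicator (neighbors E w) u"
  by (auto simp: neighbors_def indicator_def insert_commute)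

lemma sum_indicator_real_eq_card:
  "finite A \<Longrightarrow> (\<Sum>x\<in>A. indicator B x) = real (card (A \<inter> B))"
  by (induction A rule: finite_induct) (auto simp: indicator_def)

text \<open>The transition matrix has entries 1/D at adjacent pairs and 0 elsewhere; it is
  symmetric, so its columns also sum to 1. Hence the walk never concentrates: started once from
  every vertex, it puts total mass at most 1 on each \<open>w\<close>.\<close>

lemma sum_walk_dist_start_le_1:
  assumes reg: "regular_graph D V E" and D: "D \<ge> 1" and w: "w \<in> V"
  shows "(\<Sum>v\<in>V. pmf (walk_dist E t v) w) \<le> 1"
  using w
proof (induction t arbitrary: w)
  case 0
  have fin: "finite V" using reg by (simp add: regular_graph_def simple_graph_def)
  show ?case using 0 fin by (simp add: pmf_return indicator_def)
next
  case (Suc t)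
  have fin: "finite V" using reg by (simp add: regular_graph_def simple_graph_def)
  have "(\<Sum>v\<in>V. pmf (walk_dist E (Suc t) v) w)
    = (\<Sum>v\<in>V. \<Sum>u\<in>V. pmf (walk_dist E t v) u * (indicator (neighbors E u) w / D))"
    by (intro sum.cong refl pmf_walk_dist_Suc[OF reg D])
  \<comment> \<open>Summing over the starts first isolates the quantity bounded by the induction
    hypothesis at \<open>u\<close>; symmetry of adjacency turns the remaining weights into the
    degree of \<open>w\<close> over \<open>D\<close>.\<close>
  also have "\<dots> = (\<Sum>u\<in>V. (\<Sum>v\<in>V. pmf (walk_dist E t v) u) * (indicator (neighbors E w) u / D))"
    unfolding sum_distrib_right by (subst sum.swap) (simp only: indicator_neighbors_commute)
  also have "\<dots> \<le> (\<Sum>u\<in>V. 1 * (indicator (neighbors E w) u / D))"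
    by (intro sum_mono mult_right_mono Suc.IH) auto
  also have "\<dots> = real (card (neighbors E w)) / D"
    using fin neighbors_subset[OF reg, of w]
    by (simp add: sum_divide_distrib[symmetric] sum_indicator_real_eq_card Int_absorb1)
  also have "\<dots> = 1" using reg D Suc.prems by (simp add: regular_graph_def)
  finally show ?case .
qed

section \<open>Edge boundaries, and the probability that the walk crosses them\<close>

lemma edge_count_eq_sum:
  assumes "finite S" "finite T" "S \<inter> T = {}"
  shows "edge_count E S T = (\<Sum>u\<in>S. card (neighbors E u \<inter> T))"
proof -
  \<comment> \<open>Disjointness of \<open>S\<close> and \<open>T\<close> determines which endpoint
    comes first, so no edge is counted twice.\<close>
  have "inj_on (\<lambda>(u, w). {u, w}) (SIGMA u:S. neighbors E u \<inter> T)"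
    using assms(3) by (auto simp: inj_on_def doubleton_eq_iff)
  moreover have "{e \<in> E. \<exists>x\<in>S. \<exists>y\<in>T. e = {x, y}}
    = (\<lambda>(u, w). {u, w}) ` (SIGMA u:S. neighbors E u \<inter> T)"
    by (auto simp: neighbors_def image_iff)
  ultimately have "edge_count E S T = card (SIGMA u:S. neighbors E u \<inter> T)"
    by (simp add: edge_count_def card_image)
  then show ?thesis using assms by simp
qed

lemma edge_count_commute: "edge_count E S T = edge_count E T S"
proof -
  have "{e \<in> E. \<exists>x\<in>S. \<exists>y\<in>T. e = {x, y}} = {e \<in> E. \<exists>x\<in>T. \<exists>y\<in>S. e = {x, y}}"
    by (blast intro: insert_commute)
  then show ?thesis by (simp add: edge_count_def)
qed

text \<open>An edge between two subsets of \<open>W\<close> already lies inside \<open>W\<close>.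
  Expansion of the induced graph can therefore be tested with the edges of \<open>E\<close>
  itself.\<close>

lemma edge_count_induced:
  assumes "X \<subseteq> W" "Y \<subseteq> W"
  shows "edge_count (induced_edges E W) X Y = edge_count E X Y"
  unfolding edge_count_def induced_edges_def using assms by (intro arg_cong[where f = card]) blast

text \<open>An edge leaving the union starts in \<open>S\<close> or in \<open>X\<close>. If
  \<open>S\<close> has a sparse boundary in \<open>V\<close> and \<open>X\<close> has one in what
  remains after deleting \<open>S\<close>, the union is sparse too.\<close>

lemma edge_count_Un_le:
  assumes "finite V" "S \<subseteq> V" "X \<subseteq> V"
  shows "edge_count E (S \<union> X) (V - (S \<union> X)) \<le> edge_count E S (V - S) + edge_count E X (V - S - X)"
proof -
  have fin: "finite {e \<in> E. \<exists>x\<in>A. \<exists>y\<in>B. e = {x, y}}" if "A \<subseteq> V" "B \<subseteq> V" for A B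
    by (rule finite_subset[of _ "Pow V"]) (use that assms(1) in auto)
  have "card {e \<in> E. \<exists>x\<in>S \<union> X. \<exists>y\<in>V - (S \<union> X). e = {x, y}}
    \<le> card ({e \<in> E. \<exists>x\<in>S. \<exists>y\<in>V - S. e = {x, y}} \<union> {e \<in> E. \<exists>x\<in>X. \<exists>y\<in>V - S - X. e = {x, y}})"
    using assms by (intro card_mono finite_UnI fin) blast+
  also have "\<dots> \<le> card {e \<in> E. \<exists>x\<in>S. \<exists>y\<in>V - S. e = {x, y}}
      + card {e \<in> E. \<exists>x\<in>X. \<exists>y\<in>V - S - X. e = {x, y}}"
    by (rule card_Un_le)
  finally show ?thesis by (simp add: edge_count_def)
qed

text \<open>Induction on time: a walk outside \<open>S\<close> after a further step was either
  outside before or crosses the boundary in that step. Since each vertex of \<open>S\<close> carries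
  total mass at most 1, every step adds at most the number of boundary edges over
  \<open>D\<close>.\<close>

lemma walk_escape_le:
  assumes reg: "regular_graph D V E" and D: "D \<ge> 1" and S: "S \<subseteq> V"
  shows "(\<Sum>v\<in>S. measure_pmf.prob (walk_dist E t v) (V - S)) \<le> t * (edge_count E S (V - S) / D)"
proof (induction t)
  case 0
  then show ?case by (simp add: indicator_def)
next
  case (Suc t)
  have fin: "finite V" using reg by (simp add: regular_graph_def simple_graph_def)
  have finS: "finite S" using S fin finite_subset by blast
  let ?p = "\<lambda>v. pmf (walk_dist E t v)"
  \<comment> \<open>The probability that a step from \<open>u\<close> ends outside
    \<open>S\<close>.\<close>
  define r where "r u = real (card (neighbors E u \<inter> (V - S))) / D" for u
  have r1: "r u \<le> 1" if "u \<in> V" for u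
    using that reg D card_mono[OF finite_neighbors[OF reg], of "neighbors E u \<inter> (V - S)" u]
    by (auto simp: r_def regular_graph_def)
  have r0: "0 \<le> r u" for u by (simp add: r_def)
  have step: "measure_pmf.prob (walk_dist E (Suc t) v) (V - S) = (\<Sum>u\<in>V. ?p v u * r u)"
    if "v \<in> S" for v
  proof -
    have "measure_pmf.prob (walk_dist E (Suc t) v) (V - S)
      = (\<Sum>w\<in>V - S. \<Sum>u\<in>V. ?p v u * (indicator (neighbors E u) w / D))"
      using fin pmf_walk_dist_Suc[OF reg D subsetD[OF S that]]
      by (simp add: measure_measure_pmf_finite del: walk_dist.simps)
    also have "\<dots> = (\<Sum>u\<in>V. ?p v u * ((\<Sum>w\<in>V - S. indicator (neighbors E u) w) / D))"
      by (subst sum.swap) (simp add: sum_distrib_left sum_divide_distrib)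
    also have "\<dots> = (\<Sum>u\<in>V. ?p v u * r u)"
      using fin by (simp add: r_def sum_indicator_real_eq_card Int_commute)
    finally show ?thesis .
  qed
  have "(\<Sum>v\<in>S. measure_pmf.prob (walk_dist E (Suc t) v) (V - S))
    = (\<Sum>v\<in>S. \<Sum>u\<in>V. ?p v u * r u)"
    by (intro sum.cong refl step)
  also have "\<dots> = (\<Sum>v\<in>S. \<Sum>u\<in>V - S. ?p v u * r u) + (\<Sum>v\<in>S. \<Sum>u\<in>S. ?p v u * r u)"
    by (simp add: sum.subset_diff[OF S fin] sum.distrib)
  \<comment> \<open>Walks already outside are counted in full, whether or not they return.\<close>
  also have "(\<Sum>v\<in>S. \<Sum>u\<in>V - S. ?p v u * r u) \<le> (\<Sum>v\<in>S. \<Sum>u\<in>V - S. ?p v u)"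
    by (intro sum_mono mult_right_le_one_le r0 r1) auto
  also have "\<dots> = (\<Sum>v\<in>S. measure_pmf.prob (walk_dist E t v) (V - S))"
    using fin by (simp add: measure_measure_pmf_finite)
  also have "\<dots> \<le> t * (edge_count E S (V - S) / D)" by (rule Suc.IH)
  \<comment> \<open>Walks still inside: collecting the mass at each \<open>u\<close> allows
    \<open>sum_walk_dist_start_le_1\<close> to bound it by 1.\<close>
  also have "(\<Sum>v\<in>S. \<Sum>u\<in>S. ?p v u * r u) = (\<Sum>u\<in>S. (\<Sum>v\<in>S. ?p v u) * r u)"
    by (subst sum.swap) (simp add: sum_distrib_right)
  also have "\<dots> \<le> (\<Sum>u\<in>S. 1 * r u)"
  proof (intro sum_mono mult_right_mono r0)
    fix u assume "u \<in> S"
    have "(\<Sum>v\<in>S. ?p v u) \<le> (\<Sum>v\<in>V. ?p v u)"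
      by (intro sum_mono2 fin S) auto
    also have "\<dots> \<le> 1"
      by (rule sum_walk_dist_start_le_1[OF reg D]) (use \<open>u \<in> S\<close> S in auto)
    finally show "(\<Sum>v\<in>S. ?p v u) \<le> 1" .
  qed
  also have "\<dots> = edge_count E S (V - S) / D"
    using fin finS by (simp add: edge_count_eq_sum r_def sum_divide_distrib)
  finally show ?case by (simp add: algebra_simps add_divide_distrib)
qed

section \<open>Mixing forces a large edge boundary\<close>

lemma tv_dist_uniform_less:
  assumes fin: "finite V" and A: "A \<subseteq> V" and tv: "tv_dist V p (pmf_of_set V) < \<delta>"
    and V: "V \<noteq> {}"
  shows "card A / card V - \<delta> < measure_pmf.prob p A"
proof -
  have "\<bar>measure_pmf.prob p A - measure_pmf.prob (pmf_of_set V) A\<bar> \<le> tv_dist V p (pmf_of_set V)"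
    unfolding tv_dist_def using fin A by (intro Max_ge) auto
  moreover have "measure_pmf.prob (pmf_of_set V) A = card A / card V"
    using fin A V by (simp add: measure_pmf_of_set Int_absorb1)
  ultimately show ?thesis using tv by linarith
qed

text \<open>Each well-mixed start lies on one side of \<open>T\<close> and ends on the other with
  probability at least 23/60 of the density of \<open>T\<close>. The escape bound limits each of the
  two directions, whence the factor 2.\<close>

lemma edge_count_mixing_lower_bound:
  fixes \<delta> :: real
  assumes reg: "regular_graph D V E" and D: "D \<ge> 1" and T: "T \<subseteq> V"
    and \<delta>: "\<delta> \<le> 1 / 30"
    and large: "5 * \<delta> * card V < card T" and small: "real (card T) \<le> 7 / 12 * card V"
  shows "23 / 60 * card {v \<in> V. tv_dist V (walk_dist E t v) (pmf_of_set V) < \<delta>} * (card T / card V)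
    \<le> 2 * (t * (edge_count E T (V - T) / D))"
proof (cases "V = {}")
  case True
  then show ?thesis by simp
next
  case False
  have fin: "finite V" using reg by (simp add: regular_graph_def simple_graph_def)
  have finT: "finite T" using T fin finite_subset by blast
  have n0: "card V > 0" using False fin by (simp add: card_gt_0_iff)
  define G where "G = {v \<in> V. tv_dist V (walk_dist E t v) (pmf_of_set V) < \<delta>}"
  define s where "s = card T / card V"
  have s0: "0 \<le> s" and s\<delta>: "5 * \<delta> < s" and s1: "s \<le> 7 / 12"
    using n0 large small by (simp_all add: s_def field_simps)
  have cT: "card (V - T) / card V = 1 - s"
    using n0 card_mono[OF fin T]
    by (simp add: s_def card_Diff_subset[OF finT T] of_nat_diff diff_divide_distrib)
  \<comment> \<open>The constant: 1 - s - \<delta> \<ge> 1 - 7/12 - 1/30 = 23/60, and s \<le>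
    1.\<close>
  have out: "23 / 60 * s \<le> measure_pmf.prob (walk_dist E t v) (V - T)" if "v \<in> G" for v
    using tv_dist_uniform_less[OF fin _ _ False, of "V - T" "walk_dist E t v" \<delta>] that cT s0 s1 \<delta>
    by (simp add: G_def)
  \<comment> \<open>Here \<delta> < s/5, so s - \<delta> > 4s/5, which exceeds the required
    share.\<close>
  have "in": "23 / 60 * s \<le> measure_pmf.prob (walk_dist E t v) T" if "v \<in> G" for v
    using tv_dist_uniform_less[OF fin T _ False, of "walk_dist E t v" \<delta>] that s0 s\<delta>
    by (simp add: G_def s_def[symmetric])
  have "card (G \<inter> T) * (23 / 60 * s)
      \<le> (\<Sum>v\<in>G \<inter> T. measure_pmf.prob (walk_dist E t v) (V - T))"
    by (rule sum_bounded_below) (use out in auto)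
  also have "\<dots> \<le> (\<Sum>v\<in>T. measure_pmf.prob (walk_dist E t v) (V - T))"
    by (intro sum_mono2 finT) auto
  also have "\<dots> \<le> t * (edge_count E T (V - T) / D)"
    by (rule walk_escape_le[OF reg D T])
  finally have 1: "card (G \<inter> T) * (23 / 60 * s) \<le> t * (edge_count E T (V - T) / D)" .
  have "card (G - T) * (23 / 60 * s) \<le> (\<Sum>v\<in>G - T. measure_pmf.prob (walk_dist E t v) T)"
    by (rule sum_bounded_below) (use "in" in auto)
  also have "\<dots> \<le> (\<Sum>v\<in>V - T. measure_pmf.prob (walk_dist E t v) T)"
    by (intro sum_mono2) (use fin in \<open>auto simp: G_def\<close>)
  \<comment> \<open>Entering \<open>T\<close> is escaping from \<open>V - T\<close>, across the same
    boundary edges.\<close>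
  also have "\<dots> \<le> t * (edge_count E T (V - T) / D)"
    using walk_escape_le[OF reg D, of "V - T" t] T
    by (simp add: double_diff edge_count_commute[of E "V - T" T])
  finally have 2: "card (G - T) * (23 / 60 * s) \<le> t * (edge_count E T (V - T) / D)" .
  have "card G = card (G \<inter> T) + card (G - T)"
    using fin by (subst card_Un_disjoint[symmetric]) (auto simp: G_def intro: arg_cong[where f = card])
  then have "23 / 60 * card G * s = card (G \<inter> T) * (23 / 60 * s) + card (G - T) * (23 / 60 * s)"
    by (simp add: algebra_simps)
  also have "\<dots> \<le> t * (edge_count E T (V - T) / D) + t * (edge_count E T (V - T) / D)"
    by (rule add_mono[OF 1 2])
  finally have "23 / 60 * card G * s \<le> 2 * (t * (edge_count E T (V - T) / D))"
    by simp
  then show ?thesis unfolding G_def s_def .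
qed

text \<open>Excludes sparse sets of intermediate size. The inequality is strict so that it
  contradicts the weak one defining sparseness.\<close>

lemma mixing_imp_edge_count_gt:
  fixes \<epsilon> \<delta> :: real
  assumes reg: "regular_graph D V E" and D: "D \<ge> 1" and T: "T \<subseteq> V"
    and \<epsilon>: "0 < \<epsilon>" and \<delta>: "0 < \<delta>" "\<delta> \<le> 1 / 30" and \<tau>: "\<tau> \<ge> 1"
    and large: "5 * \<delta> * card V < card T" and small: "real (card T) \<le> 7 / 12 * card V"
    and mixing: "real (card {v \<in> V. tv_dist V (walk_dist E \<tau> v) (pmf_of_set V) < \<delta>})
      \<ge> \<epsilon> * card V"
  shows "\<epsilon> * D / (16 * \<tau>) * card T < edge_count E T (V - T)"
proof -
  have T0: "card T > 0"
    using large \<delta> by (metis mult_nonneg_nonneg of_nat_0_le_iff of_nat_0_less_iff order_le_less_trans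
        less_imp_le zero_le_numeral)
  then have V0: "card V > 0" using small by linarith
  have "23 / 60 * (\<epsilon> * card V) * (card T / card V)
    \<le> 23 / 60 * card {v \<in> V. tv_dist V (walk_dist E \<tau> v) (pmf_of_set V) < \<delta>} * (card T / card V)"
    using mixing by (intro mult_right_mono mult_left_mono) auto
  also have "\<dots> \<le> 2 * (\<tau> * (edge_count E T (V - T) / D))"
    by (rule edge_count_mixing_lower_bound[OF reg D T \<delta>(2) large small])
  finally have "23 / 120 * (\<epsilon> * card T) \<le> \<tau> * (edge_count E T (V - T) / D)"
    using V0 by (simp add: mult_ac)
  moreover have "\<epsilon> * card T > 0" using \<epsilon> T0 by simp
  \<comment> \<open>Strict because 1/16 < 23/120 and \<epsilon>|T| is positive.\<close>
  ultimately have "\<epsilon> * card T / 16 < \<tau> * (edge_count E T (V - T) / D)" by linarith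
  then show ?thesis using D \<tau> by (simp add: field_simps)
qed

section \<open>Removing a maximal sparse set\<close>

theorem theorem1p1:
  fixes \<epsilon> \<delta> :: real and \<tau> D n :: nat and E :: "nat set set"
  assumes "0 < \<epsilon>" and "\<epsilon> < 2 / 5"
    and "0 < \<delta>" and "\<delta> \<le> 1 / 30"
    and "\<tau> \<ge> 1" and "D \<ge> 1"
    and "regular_graph D {1..n} E"
    and "real (card {v \<in> {1..n}. tv_dist {1..n} (walk_dist E \<tau> v) (pmf_of_set {1..n}) < \<delta>})
           \<ge> \<epsilon> * real n"
  shows "\<exists>V'. V' \<subseteq> {1..n} \<and> real (card V') \<le> 5 * \<delta> * real n \<and>
    (let W = {1..n} - V'; E' = induced_edges E W; n' = card W in
      \<forall>X. X \<subseteq> W \<and> real (card X) \<le> 1 / 2 * real n' \<longrightarrow>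
        real (edge_count E' X (W - X)) \<ge> \<epsilon> * real D / (16 * real \<tau>) * real (card X))"
proof -
  define V where "V = {1..n}"
  define c where "c = \<epsilon> * real D / (16 * real \<tau>)"
  define sparse where "sparse S \<longleftrightarrow> S \<subseteq> V \<and> real (card S) \<le> 5 * \<delta> * n
    \<and> edge_count E S (V - S) \<le> c * card S" for S
  have fin: "finite V" and cV: "card V = n" by (simp_all add: V_def)
  have "sparse {}" using assms(3) by (simp add: sparse_def edge_count_def)
  moreover have "card S < Suc n" if "sparse S" for S
    using that card_mono[OF fin, of S] cV by (simp add: sparse_def)
  ultimately obtain S where S: "sparse S" and max: "\<And>S'. sparse S' \<Longrightarrow> card S' \<le> card S"
    using ex_has_greatest_nat[of sparse "{}" card "Suc n"] by (auto intro: less_imp_le)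
  have SV: "S \<subseteq> V" and cS: "real (card S) \<le> 5 * \<delta> * n" using S by (simp_all add: sparse_def)
  have finS: "finite S" using SV fin finite_subset by blast
  have "c * card X \<le> edge_count (induced_edges E (V - S)) X (V - S - X)"
    if X: "X \<subseteq> V - S" and cX: "real (card X) \<le> 1 / 2 * card (V - S)" for X
  proof (rule ccontr)
    assume "\<not> ?thesis"
    then have eX: "edge_count E X (V - S - X) < c * card X"
      using X by (simp add: edge_count_induced)
    have finX: "finite X" using X fin by (meson finite_Diff finite_subset)
    \<comment> \<open>An empty \<open>X\<close> would have a negative edge count. Thus
      \<open>T\<close> is strictly larger than \<open>S\<close>, and by maximality it cannot be
      sparse.\<close>
    have X0: "card X > 0" using eX by (cases "card X = 0") auto
    define T where "T = S \<union> X"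
    have TV: "T \<subseteq> V" using SV X by (auto simp: T_def)
    have cT: "card T = card S + card X"
      unfolding T_def using X by (intro card_Un_disjoint finS finX) auto
    have "real (edge_count E T (V - T)) \<le> edge_count E S (V - S) + edge_count E X (V - S - X)"
      unfolding T_def using edge_count_Un_le[OF fin SV, of X E] X by (simp flip: of_nat_add) blast
    also have "\<dots> \<le> c * card T"
      using S eX by (simp add: sparse_def cT distrib_left)
    finally have eT: "edge_count E T (V - T) \<le> c * card T" .
    have large: "5 * \<delta> * card V < card T"
    proof (rule ccontr)
      assume "\<not> ?thesis"
      then have "sparse T" using TV eT by (simp add: sparse_def cV)
      then show False using max[of T] cT X0 by simp
    qed
    \<comment> \<open>The constant 7/12: |T| \<le> |S| + (n - |S|)/2 = (n + |S|)/2, and |S| \<le>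
      5\<delta>n \<le> n/6.\<close>
    have "real (card (V - S)) = real n - card S"
      using card_mono[OF fin SV] by (simp add: card_Diff_subset[OF finS SV] cV of_nat_diff)
    moreover have "5 * \<delta> * n \<le> 1 / 6 * n" using assms(4) by (intro mult_right_mono) auto
    ultimately have small: "real (card T) \<le> 7 / 12 * card V"
      using cX cS cT cV by simp
    have "c * card T < edge_count E T (V - T)"
      unfolding c_def
      by (rule mixing_imp_edge_count_gt[where \<delta> = \<delta>])
        (use assms TV large small cV in \<open>simp_all add: V_def\<close>)
    then show False using eT by simp
  qed
  then show ?thesis
    using SV cS unfolding V_def c_def Let_def by blast
qed

end
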